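(* Let $X$ be a real Banach space, let $S(t,\tau)\in\mathscr{L}(X)$, $0\le t\le\tau$, be a strongly continuous backward evolution operator, and let $I_t^-,I_t^+:X\to[0,\infty)$, $t\ge0$, be two families of homogeneous (not necessarily linear) functionals such that $I_t^\pm(v)$ is continuous in $(t,v)\in[0,\infty)\times X$. Assume that there exist $c_1>0$, $c_2>0$, $K\in\{0,1,2,\ldots\}$, $\alpha_{k,t}^-\in X^*$ for $(k,t)\in\{1,\ldots,K\}\times[0,\infty)$, $c_3,c_4>0$ and $-\infty<\lambda<\mu<\infty$ such that: \begin{enumerate} \item $c_1\|v\|_X\le I_t^-(v)+I_t^+(v)\le\frac1{c_1}\|v\|_X$ for all $t\ge0$, $v\in X$; \item $c_2\max_{1\le k\le K}|\langle\alpha_{k,t}^-,v\rangle|\le I_t^-(v)\le\frac1{c_2}\max_{1\le k\le K}|\langle\alpha_{k,t}^-,v\rangle|$ for all $t\ge0$, $v\in X$ (no continuity of $\alpha_{k,t}^-$ in $t$ is required); \item $\mathcal{V}_{\mathrm s}(c_3,t)$ contains a linear space of dimension $K$ for all $t\ge0$; \item $c_4>3(c_1c_2)^{-2}(c_3+1)$; \item for all $0\le t\le\tau$ and $v_\tau\in X$, $I_\tau^-(v_\tau)\le e^{\lambda(\tau-t)}I_t^-(S(t,\tau)v_\tau)$ whenever $S(t',\tau)v_\tau\in\mathcal{V}_{\mathrm s}(c_4,t')$ for all $t'\in[t,\tau]$; \item for all $0\le t\le\tau$ and $v_\tau\in X$, $I_\tau^+(v_\tau)\ge e^{\mu(\tau-t)}I_t^+(S(t,\tau)v_\tau)$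 whenever $S(t',\tau)v_\tau\in\mathcal{V}_{\mathrm u}(c_3,t')$ for all $t'\in[t,\tau]$. \end{enumerate} Then the system $v(t)=S(t,\tau)v(\tau)$ has an exponential dichotomy with exponents $\lambda$ and $\mu$. For all $t\ge0$ the stable subspace $X_{\mathrm s}(t)$ is contained in $\mathcal{V}_{\mathrm s}(c_3,t)$ and has dimension $K$.
   Context: $\mathscr{L}(X)$ denotes bounded linear operators on $X$. Homogeneous means $I(\lambda v)=|\lambda|I(v)$ for $\lambda\in\mathbb{R}$. A maximum over an empty index set is $0$. A family $S(t,\tau)\in\mathscr{L}(X)$, $0\le t\le\tau$, is a strongly continuous backward evolution operator if (1) $S(t,t)=\mathrm{Id}$ for all $t\ge0$; (2) for all $\tau\ge0$ and $v_\tau\in X$ the function $[0,\tau]\ni t\mapsto S(t,\tau)v_\tau\in X$ is continuous; (3) $S(t,s)\circ S(s,\tau)=S(t,\tau)$ for $0\le t\le s\le\tau$. $S(t,\tau)$ need not be invertible. Cones: for $c>0$, $\mathcal{V}_{\mathrm s}(c,t):=\{v\in X:I_t^+(v)\le cI_t^-(v)\}$, $\mathcal{V}_{\mathrm u}(c,t):=\{v\in X:I_t^+(v)\ge cI_t^-(v)\}$. Exponential dichotomy with exponents $\lambda<\mu$: for all $t\ge0$ there is a direct sum decomposition $X=X_{\mathrm s}(t)\oplus X_{\mathrm u}(t)$ with associated projections $\pi_{\mathrm s}(t),\pi_{\mathrm u}(t)$ onto $X_{\mathrm s}(t),X_{\mathrm u}(t)$, and a constant $C$, such that for all $0\le t\le\tau$: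 (1) $S(t,\tau)\circ\pi_{\mathrm s}(\tau)=\pi_{\mathrm s}(t)\circ S(t,\tau)$ and $S(t,\tau)\circ\pi_{\mathrm u}(\tau)=\pi_{\mathrm u}(t)\circ S(t,\tau)$; (2) $\|\pi_{\mathrm s}(t)\|_{\mathscr{L}(X)}+\|\pi_{\mathrm u}(t)\|_{\mathscr{L}(X)}\le C$; (3) $S(t,\tau)|_{X_{\mathrm s}(\tau)}:X_{\mathrm s}(\tau)\to X_{\mathrm s}(t)$ is invertible; (4) $\|S(t,\tau)^{-1}v_t\|\le Ce^{\lambda(\tau-t)}\|v_t\|$ for all $v_t\in X_{\mathrm s}(t)$, where $S(t,\tau)^{-1}$ is the inverse of the restriction in (3); (5) $\|S(t,\tau)v_\tau\|\le Ce^{\mu(t-\tau)}\|v_\tau\|$ for all $v_\tau\in X_{\mathrm u}(\tau)$. $X_{\mathrm s}(t)$ is called the stable subspace. *)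

theory Defs
  imports "HOL-Analysis.Analysis"
begin

text \<open>
  Time-dependent objects are total functions on \<^typ>\<open>real\<close>; only their values at times
  \<open>0 \<le> t \<le> \<tau>\<close> are ever constrained or used.
\<close>

definition backward_evolution_operator ::
    "(real \<Rightarrow> real \<Rightarrow> 'a::real_normed_vector \<Rightarrow>\<^sub>L 'a) \<Rightarrow> bool" where
  "backward_evolution_operator S \<longleftrightarrow>
     (\<forall>t\<ge>0. S t t = id_blinfun) \<and>
     (\<forall>\<tau>\<ge>0. \<forall>v. continuous_on {0..\<tau>} (\<lambda>t. blinfun_apply (S t \<tau>) v)) \<and>
     (\<forall>t s \<tau>. 0 \<le> t \<and> t \<le> s \<and> s \<le> \<tau> \<longrightarrow> S t s o\<^sub>L S s \<tau> = S t \<tau>)"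

definition homogeneous :: "('a::real_vector \<Rightarrow> real) \<Rightarrow> bool" where
  "homogeneous I \<longleftrightarrow> (\<forall>r v. I (r *\<^sub>R v) = \<bar>r\<bar> * I v)"

definition stable_cone ::
    "(real \<Rightarrow> 'a \<Rightarrow> real) \<Rightarrow> (real \<Rightarrow> 'a \<Rightarrow> real) \<Rightarrow> real \<Rightarrow> real \<Rightarrow> 'a set" where
  "stable_cone Iminus Iplus c t = {v. Iplus t v \<le> c * Iminus t v}"

definition unstable_cone ::
    "(real \<Rightarrow> 'a \<Rightarrow> real) \<Rightarrow> (real \<Rightarrow> 'a \<Rightarrow> real) \<Rightarrow> real \<Rightarrow> real \<Rightarrow> 'a set" where
  "unstable_cone Iminus Iplus c t = {v. Iplus t v \<ge> c * Iminus t v}"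

text \<open>
  The library constant \<^const>\<open>dim\<close> is 0 on infinite-dimensional spaces, so \<open>dim V = 0\<close>
  would not force \<open>V = {0}\<close>. Hence the explicit finite basis.
\<close>

definition subspace_of_dimension :: "'a::real_vector set \<Rightarrow> nat \<Rightarrow> bool" where
  "subspace_of_dimension V K \<longleftrightarrow>
     (\<exists>B. finite B \<and> card B = K \<and> independent B \<and> span B = V)"

text \<open>
  The numbers compared are nonnegative, so inserting 0 only affects the empty maximum
  (\<open>K = 0\<close>), which is 0 by convention.
\<close>

definition max_abs_pairing ::
    "(nat \<Rightarrow> real \<Rightarrow> 'a::real_normed_vector \<Rightarrow>\<^sub>L real) \<Rightarrow> nat \<Rightarrow> real \<Rightarrow> 'a \<Rightarrow> real" where
  "max_abs_pairing \<alpha> K t v = Max (insert 0 ((\<lambda>k. \<bar>blinfun_apply (\<alpha> k t) v\<bar>) ` {1..K}))"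

definition direct_sum_decomposition :: "'a::real_vector set \<Rightarrow> 'a set \<Rightarrow> bool" where
  "direct_sum_decomposition V W \<longleftrightarrow>
     subspace V \<and> subspace W \<and> V \<inter> W = {0} \<and> (\<forall>x. \<exists>v\<in>V. \<exists>w\<in>W. x = v + w)"

definition associated_projections ::
    "'a::real_normed_vector set \<Rightarrow> 'a set \<Rightarrow> ('a \<Rightarrow>\<^sub>L 'a) \<Rightarrow> ('a \<Rightarrow>\<^sub>L 'a) \<Rightarrow> bool" where
  "associated_projections V W P Q \<longleftrightarrow>
     (\<forall>x. blinfun_apply P x \<in> V \<and> blinfun_apply Q x \<in> W \<and>
          x = blinfun_apply P x + blinfun_apply Q x)"

text \<open>
  The families \<open>Xs\<close> and \<open>Xu\<close> are arguments, so that the stable subspaces of the dichotomy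
  can be referred to. The constant \<open>C\<close> does not depend on the times.
\<close>

definition exponential_dichotomy_on ::
    "(real \<Rightarrow> real \<Rightarrow> 'a::real_normed_vector \<Rightarrow>\<^sub>L 'a) \<Rightarrow> real \<Rightarrow> real \<Rightarrow>
     (real \<Rightarrow> 'a set) \<Rightarrow> (real \<Rightarrow> 'a set) \<Rightarrow> bool" where
  "exponential_dichotomy_on S lam mu Xs Xu \<longleftrightarrow>
     lam < mu \<and>
     (\<forall>t\<ge>0. direct_sum_decomposition (Xs t) (Xu t)) \<and>
     (\<exists>\<pi>s \<pi>u C.
        (\<forall>t\<ge>0. associated_projections (Xs t) (Xu t) (\<pi>s t) (\<pi>u t)) \<and>
        (\<forall>t \<tau>. 0 \<le> t \<and> t \<le> \<tau> \<longrightarrow>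
           S t \<tau> o\<^sub>L \<pi>s \<tau> = \<pi>s t o\<^sub>L S t \<tau> \<and>
           S t \<tau> o\<^sub>L \<pi>u \<tau> = \<pi>u t o\<^sub>L S t \<tau> \<and>
           norm (\<pi>s t) + norm (\<pi>u t) \<le> C \<and>
           bij_betw (blinfun_apply (S t \<tau>)) (Xs \<tau>) (Xs t) \<and>
           (\<forall>v\<in>Xs t. norm (inv_into (Xs \<tau>) (blinfun_apply (S t \<tau>)) v)
                       \<le> C * exp (lam * (\<tau> - t)) * norm v) \<and>
           (\<forall>v\<in>Xu \<tau>. norm (blinfun_apply (S t \<tau>) v)
                       \<le> C * exp (mu * (t - \<tau>)) * norm v)))"

end

theory Submission
  imports Defs
begin

text \<open>
  Run backwards in time, the evolution expands the functional \<open>Iminus\<close> faster than \<open>Iplus\<close> as long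
  as an orbit stays between the two cones. Hence the ratio of \<open>Iplus\<close> to \<open>Iminus\<close> can only fall
  there, and an orbit that is in a stable cone of opening \<open>c\<close>, \<open>c3 \<le> c < c4\<close>, remains in it for
  all earlier times (\<open>stable_cone_invariant\<close>).

  The unstable space at time \<open>t\<close> can be prescribed at time \<open>0\<close> and pulled back: it consists of the
  \<open>v\<close> for which \<open>S 0 t v\<close> is annihilated by \<open>\<alpha> 1 0, \<dots>, \<alpha> K 0\<close>. Their orbits end
  with \<open>Iminus = 0\<close>, so by invariance a nonzero one never was in a stable cone of opening below
  \<open>c4\<close> (\<open>kernel_orbit_in_unstable_cone\<close>), and it decays. The spaces have codimension at most \<open>K\<close>.

  The stable space is determined by the far future. Take a \<open>K\<close>-dimensional space in the stable cone
  at a time \<open>\<tau>\<close> and evolve it back to \<open>t\<close>. It stays in the stable cone, keeps its dimension and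
  meets the unstable space only in \<open>0\<close>, hence complements it
  (\<open>evolved_space_complements_unstable_space\<close>). The gap between \<open>c3\<close> and \<open>c4\<close> bounds the
  projections along the unstable space uniformly in \<open>t\<close> and \<open>\<tau>\<close> (\<open>splitting_bound\<close>).
  Changing \<open>\<tau>\<close> to a later time changes the projection only by a vector that was at most a multiple of
  \<open>exp (lam * (\<tau> - t))\<close> at time \<open>\<tau>\<close> and has been contracted by \<open>exp (mu * (t - \<tau>))\<close> since
  (\<open>approx_proj_diff_bound\<close>). As \<open>lam < mu\<close>, the projections converge as \<open>\<tau>\<close> tends to
  infinity. The limit is a projection that commutes with the evolution, and its range is the stable
  space. The argument uses completeness of the space but no compactness.
\<close>

section \<open>Finite-dimensional complements of common kernels\<close>

text \<open>
  Each further functional costs at most one dimension: if it does not vanish on the common kernel of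
  the previous ones, one vector of that kernel corrects its value without disturbing the others.
\<close>
lemma codimension_common_kernel:
  fixes f :: "nat \<Rightarrow> 'a::real_vector \<Rightarrow> real"
  assumes lin: "\<And>k. linear (f k)"
  shows "\<exists>C. finite C \<and> card C \<le> K \<and> (\<forall>x. \<exists>w\<in>span C. \<forall>k\<in>{1..K}. f k w = f k x)"
proof (induction K)
  case 0
  show ?case by (rule exI[of _ "{}"]) auto
next
  case (Suc K)
  then obtain C where C: "finite C" "card C \<le> K"
    and sp: "\<And>x. \<exists>w\<in>span C. \<forall>k\<in>{1..K}. f k w = f k x" by blast
  show ?case
  proof (cases "\<exists>y. (\<forall>k\<in>{1..K}. f k y = 0) \<and> f (Suc K) y \<noteq> 0")
    case True
    then obtain y where y: "\<And>k. k \<in> {1..K} \<Longrightarrow> f k y = 0" "f (Suc K) y \<noteq> 0" by blast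
    have "\<exists>w\<in>span (insert y C). \<forall>k\<in>{1..Suc K}. f k w = f k x" for x
    proof -
      obtain w where w: "w \<in> span C" "\<And>k. k \<in> {1..K} \<Longrightarrow> f k w = f k x"
        using sp by blast
      \<comment> \<open>The multiple of \<open>y\<close> that gives the new functional the right value.\<close>
      define r where "r = (f (Suc K) x - f (Suc K) w) / f (Suc K) y"
      have "w + r *\<^sub>R y \<in> span (insert y C)"
        using w(1) by (meson insertI1 span_add span_base span_mono span_scale subsetD subset_insertI)
      moreover have "f k (w + r *\<^sub>R y) = f k x" if "k \<in> {1..Suc K}" for k
      proof -
        have e: "f k (w + r *\<^sub>R y) = f k w + r * f k y"
          by (simp add: linear_add[OF lin] linear_scale[OF lin])
        show ?thesis
        proof (cases "k = Suc K")
          case True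
          then show ?thesis using e y(2) by (simp add: r_def)
        next
          case False
          then show ?thesis using e w(2)[of k] y(1)[of k] that by auto
        qed
      qed
      ultimately show ?thesis by blast
    qed
    moreover have "card (insert y C) \<le> Suc K" using C by (simp add: card_insert_if)
    ultimately show ?thesis using C(1) by (intro exI[of _ "insert y C"]) auto
  next
    case False
    have "\<exists>w\<in>span C. \<forall>k\<in>{1..Suc K}. f k w = f k x" for x
    proof -
      obtain w where w: "w \<in> span C" "\<And>k. k \<in> {1..K} \<Longrightarrow> f k w = f k x"
        using sp by blast
      have "\<forall>k\<in>{1..K}. f k (x - w) = 0" using w by (auto simp: linear_diff[OF lin])
      then have "f (Suc K) (x - w) = 0" using False by blast
      then have "\<forall>k\<in>{1..Suc K}. f k w = f k x"
        using w(2) by (auto simp: linear_diff[OF lin] le_Suc_eq)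
      then show ?thesis using w(1) by blast
    qed
    then show ?thesis using C by (meson le_SucI)
  qed
qed

lemma subspace_of_dimension_subspace:
  "subspace_of_dimension V K \<Longrightarrow> subspace V"
  unfolding subspace_of_dimension_def by auto

lemma subspace_of_dimension_injective_image:
  assumes V: "subspace_of_dimension V K" and g: "linear g"
    and inj: "\<And>v. v \<in> V \<Longrightarrow> g v = 0 \<Longrightarrow> v = 0"
  shows "subspace_of_dimension (g ` V) K"
proof -
  obtain B where B: "finite B" "card B = K" "independent B" "span B = V"
    using V unfolding subspace_of_dimension_def by blast
  have i: "inj_on g (span B)"
    using inj linear_inj_on_iff_eq_0[OF g subspace_span] B(4) by blast
  then have "inj_on g B" using inj_on_subset span_superset by blast
  then have "card (g ` B) = K" using B card_image by blast
  moreover have "independent (g ` B)" by (rule linear_independent_injective_image[OF g B(3) i])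
  moreover have "span (g ` B) = g ` V" using linear_span_image[OF g] B(4) by simp
  ultimately show ?thesis unfolding subspace_of_dimension_def using B(1) by blast
qed

text \<open>
  The ambient space may be infinite-dimensional, so the dimension count rests on the exchange lemma:
  a vector of \<open>span C\<close> outside \<open>W\<close> would give \<open>K + 1\<close> independent vectors in the span of at most
  \<open>K\<close>.
\<close>
lemma subspace_of_dimension_spans_if_subset:
  assumes W: "subspace_of_dimension W K" and sub: "W \<subseteq> span C" and C: "finite C" "card C \<le> K"
  shows "W = span C"
proof (rule antisym[OF sub subsetI])
  fix x assume x: "x \<in> span C"
  obtain B where B: "finite B" "card B = K" "independent B" "span B = W"
    using W unfolding subspace_of_dimension_def by blast
  show "x \<in> W"
  proof (rule ccontr)
    assume "x \<notin> W"
    then have nx: "x \<notin> span B" using B(4) by simp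
    then have "independent (insert x B)" using B(3) independent_insertI by blast
    moreover have "insert x B \<subseteq> span C"
      using x sub B(4) span_superset[of B] by blast
    ultimately have "card (insert x B) \<le> card C" using independent_span_bound[OF C(1)] by blast
    moreover have "x \<notin> B" using nx span_base by blast
    ultimately show False using B(1,2) C(2) by simp
  qed
qed

text \<open>
  A \<open>K\<close>-dimensional space that meets the common kernel of \<open>K\<close> functionals trivially complements
  that kernel. Modulo the kernel, every vector lies in a fixed \<open>span C\<close> with at most \<open>K\<close> generators;
  \<open>V\<close> maps injectively, hence by dimension onto, this span.
\<close>
lemma transversal_represents_functionals:
  fixes f :: "nat \<Rightarrow> 'a::real_vector \<Rightarrow> real"
  assumes lin: "\<And>k. linear (f k)" and V: "subspace_of_dimension V K"
    and tr: "\<And>v. v \<in> V \<Longrightarrow> \<forall>k\<in>{1..K}. f k v = 0 \<Longrightarrow> v = 0"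
  shows "\<exists>v\<in>V. \<forall>k\<in>{1..K}. f k v = f k x"
proof -
  obtain B where B: "finite B" "card B = K" "independent B" "span B = V"
    using V unfolding subspace_of_dimension_def by blast
  obtain C where C: "finite C" "card C \<le> K"
    and "\<And>x. \<exists>w\<in>span C. \<forall>k\<in>{1..K}. f k w = f k x"
    using codimension_common_kernel[of f K, OF lin] by blast
  then obtain c where c: "\<And>x. c x \<in> span C" "\<And>x k. k \<in> {1..K} \<Longrightarrow> f k (c x) = f k x"
    by metis
  obtain g where g: "linear g" "\<And>b. b \<in> B \<Longrightarrow> g b = c b"
    using linear_independent_extend[OF B(3), of c] by blast
  have gC: "g v \<in> span C" if "v \<in> V" for v
  proof -
    have "g ` span B = span (g ` B)" using linear_span_image[OF g(1)] by simp
    also have "\<dots> \<subseteq> span C" using g(2) c(1) by (intro span_minimal) auto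
    finally show ?thesis using that B(4) by blast
  qed
  have fg: "f k (g v) = f k v" if "v \<in> V" "k \<in> {1..K}" for k v
  proof -
    have "(f k \<circ> g) v = f k v"
      using linear_eq_on_span[OF linear_compose[OF g(1) lin] lin, of B k k v] that g(2) c(2) B(4)
      by auto
    then show ?thesis by simp
  qed
  have "subspace_of_dimension (g ` V) K"
  proof (rule subspace_of_dimension_injective_image[OF V g(1)])
    fix v assume v: "v \<in> V" "g v = 0"
    then have "\<forall>k\<in>{1..K}. f k v = 0" using fg[OF v(1)] linear_0[OF lin] by simp
    then show "v = 0" using tr v(1) by blast
  qed
  then have "g ` V = span C"
    using subspace_of_dimension_spans_if_subset gC C by blast
  then obtain v where v: "v \<in> V" "c x = g v" using c(1)[of x] by blast
  then have "\<forall>k\<in>{1..K}. f k v = f k x" using fg[OF v(1)] c(2)[of _ x] by simp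
  then show ?thesis using v(1) by blast
qed

lemma linear_blinfun: "linear (blinfun_apply (F :: 'a::real_normed_vector \<Rightarrow>\<^sub>L 'b::real_normed_vector))"
  by (rule bounded_linear.linear[OF blinfun.bounded_linear_right])

section \<open>Invariance of the cones\<close>

text \<open>
  The inequality \<open>c3 + 1 < (c1 * c2)\<^sup>2 * c4\<close> makes the stable and the unstable cone uniformly
  transversal, and \<open>c3 < c4\<close> leaves room for an orbit between them. The first one implies the second
  one if \<open>c1 * c2 \<le> 1\<close>, but \<open>c1 * c2\<close> may exceed \<open>1\<close> if \<open>K = 0\<close>.
\<close>
locale invariant_cones =
  fixes S :: "real \<Rightarrow> real \<Rightarrow> 'a::banach \<Rightarrow>\<^sub>L 'a"
    and Im Ip :: "real \<Rightarrow> 'a \<Rightarrow> real"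
    and \<alpha> :: "nat \<Rightarrow> real \<Rightarrow> 'a \<Rightarrow>\<^sub>L real"
    and c1 c2 c3 c4 lam mu :: real
    and K :: nat
  assumes evolution: "backward_evolution_operator S"
    and nonneg: "0 \<le> t \<Longrightarrow> 0 \<le> Im t v" "0 \<le> t \<Longrightarrow> 0 \<le> Ip t v"
    and cont: "continuous_on ({0..} \<times> UNIV) (\<lambda>(t, v). Im t v)"
      "continuous_on ({0..} \<times> UNIV) (\<lambda>(t, v). Ip t v)"
    and pos: "c1 > 0" "c2 > 0" "c3 > 0"
    and exponents: "lam < mu"
    and norm_equiv: "0 \<le> t \<Longrightarrow> c1 * norm v \<le> Im t v + Ip t v"
      "0 \<le> t \<Longrightarrow> Im t v + Ip t v \<le> 1 / c1 * norm v"
    and seminorm_equiv: "0 \<le> t \<Longrightarrow> c2 * max_abs_pairing \<alpha> K t v \<le> Im t v"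
      "0 \<le> t \<Longrightarrow> Im t v \<le> 1 / c2 * max_abs_pairing \<alpha> K t v"
    and subspace_in_cone: "0 \<le> t \<Longrightarrow> \<exists>V. subspace_of_dimension V K \<and> V \<subseteq> stable_cone Im Ip c3 t"
    and cone_gap: "c3 < c4" "c3 + 1 < (c1 * c2)\<^sup>2 * c4"
    and growth: "\<lbrakk>0 \<le> t; t \<le> \<tau>; \<And>t'. t' \<in> {t..\<tau>} \<Longrightarrow> S t' \<tau> v \<in> stable_cone Im Ip c4 t'\<rbrakk>
      \<Longrightarrow> Im \<tau> v \<le> exp (lam * (\<tau> - t)) * Im t (S t \<tau> v)"
    and decay: "\<lbrakk>0 \<le> t; t \<le> \<tau>; \<And>t'. t' \<in> {t..\<tau>} \<Longrightarrow> S t' \<tau> v \<in> unstable_cone Im Ip c3 t'\<rbrakk>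
      \<Longrightarrow> exp (mu * (\<tau> - t)) * Ip t (S t \<tau> v) \<le> Ip \<tau> v"
begin

lemma S_refl [simp]: "0 \<le> t \<Longrightarrow> S t t v = v"
  using evolution unfolding backward_evolution_operator_def by simp

lemma S_compose:
  assumes "0 \<le> t" "t \<le> s" "s \<le> \<tau>" shows "S t s (S s \<tau> v) = S t \<tau> v"
proof -
  have "S t s o\<^sub>L S s \<tau> = S t \<tau>"
    using assms evolution unfolding backward_evolution_operator_def by blast
  then show ?thesis by (metis blinfun_apply_blinfun_compose)
qed

lemma continuous_orbit: "0 \<le> \<tau> \<Longrightarrow> continuous_on {0..\<tau>} (\<lambda>t. S t \<tau> v)"
  using evolution unfolding backward_evolution_operator_def by blast

lemma continuous_along_orbit:
  assumes "0 \<le> \<tau>"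
  shows "continuous_on {0..\<tau>} (\<lambda>t. Im t (S t \<tau> v))"
    and "continuous_on {0..\<tau>} (\<lambda>t. Ip t (S t \<tau> v))"
proof -
  have p: "continuous_on {0..\<tau>} (\<lambda>t. (t, S t \<tau> v))"
    by (intro continuous_intros continuous_orbit assms)
  have im: "(\<lambda>t. (t, S t \<tau> v)) ` {0..\<tau>} \<subseteq> {0..} \<times> UNIV" by auto
  show "continuous_on {0..\<tau>} (\<lambda>t. Im t (S t \<tau> v))"
    using continuous_on_compose2[OF cont(1) p im] by simp
  show "continuous_on {0..\<tau>} (\<lambda>t. Ip t (S t \<tau> v))"
    using continuous_on_compose2[OF cont(2) p im] by simp
qed

lemma tendsto_functional:
  assumes "0 \<le> t" "(x \<longlongrightarrow> v) F"
  shows "((\<lambda>n. Im t (x n)) \<longlongrightarrow> Im t v) F" "((\<lambda>n. Ip t (x n)) \<longlongrightarrow> Ip t v) F"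
proof -
  have p: "continuous_on UNIV (\<lambda>v. (t, v))" by (intro continuous_intros)
  have "continuous_on UNIV (Im t)" "continuous_on UNIV (Ip t)"
    using continuous_on_compose2[OF cont(1) p] continuous_on_compose2[OF cont(2) p] assms(1)
    by auto
  then show "((\<lambda>n. Im t (x n)) \<longlongrightarrow> Im t v) F" "((\<lambda>n. Ip t (x n)) \<longlongrightarrow> Ip t v) F"
    using assms(2) by (auto simp: continuous_on_eq_continuous_at intro: isCont_tendsto_compose)
qed

lemma eq_zero_if_functionals_zero:
  assumes "0 \<le> t" "Im t v = 0" "Ip t v \<le> 0" shows "v = 0"
proof -
  have "c1 * norm v \<le> 0" using norm_equiv(1)[OF assms(1), of v] assms by simp
  then show ?thesis using pos(1) by (simp add: mult_le_0_iff)
qed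

lemma functionals_zero: "0 \<le> t \<Longrightarrow> Im t 0 = 0" "0 \<le> t \<Longrightarrow> Ip t 0 = 0"
  using norm_equiv(2)[of t 0] nonneg[of t 0] by auto

lemma stable_cone_mono:
  "0 \<le> t \<Longrightarrow> c \<le> c' \<Longrightarrow> v \<in> stable_cone Im Ip c t \<Longrightarrow> v \<in> stable_cone Im Ip c' t"
  unfolding stable_cone_def using nonneg(1)[of t v] mult_right_mono[of c c' "Im t v"] by auto

text \<open>
  At an exit time \<open>s\<close> the ratio of \<open>Ip\<close> to \<open>Im\<close> equals \<open>c\<close>, and by continuity it stays between
  \<open>c3\<close> and \<open>c4\<close> just before \<open>s\<close>. Both the growth and the decay estimate apply there, and they
  make the ratio at those earlier times at most \<open>c\<close>, a contradiction. The openings \<open>c\<close> strictly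
  below \<open>c4\<close> are needed to have this margin.
\<close>
lemma stable_cone_invariant:
  assumes c: "c3 \<le> c" "c < c4" and t: "0 \<le> t" "t \<le> \<tau>" and v: "v \<in> stable_cone Im Ip c \<tau>"
  shows "S t \<tau> v \<in> stable_cone Im Ip c t"
proof (rule ccontr)
  assume not: "S t \<tau> v \<notin> stable_cone Im Ip c t"
  define g where "g r = Ip r (S r \<tau> v) - c * Im r (S r \<tau> v)" for r
  define h where "h r = c4 * Im r (S r \<tau> v) - Ip r (S r \<tau> v)" for r
  have c_pos: "0 < c" using c(1) pos by linarith
  have gt: "0 < g t" using not unfolding g_def stable_cone_def by simp
  have g\<tau>: "g \<tau> \<le> 0" using v t unfolding g_def stable_cone_def by simp
  have "continuous_on {0..\<tau>} g" unfolding g_def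
    by (intro continuous_intros continuous_along_orbit) (use t in auto)
  then have cg: "continuous_on {t..\<tau>} g" by (rule continuous_on_subset) (use t in auto)
  have "continuous_on {0..\<tau>} h" unfolding h_def
    by (intro continuous_intros continuous_along_orbit) (use t in auto)
  then have ch: "continuous_on {t..\<tau>} h" by (rule continuous_on_subset) (use t in auto)
  \<comment> \<open>\<open>s\<close> is the earliest time in \<open>[t, \<tau>]\<close> at which the orbit is in the cone; on \<open>[t, s)\<close> it is
    outside.\<close>
  define Z where "Z = {r \<in> {t..\<tau>}. g r \<le> 0}"
  have "closed Z" unfolding Z_def
    by (intro continuous_on_closed_Collect_le cg) auto
  moreover have "Z \<noteq> {}" "bdd_below Z" using g\<tau> t unfolding Z_def by auto
  ultimately have "Inf Z \<in> Z" using closed_contains_Inf by blast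
  define s where "s = Inf Z"
  have s: "t \<le> s" "s \<le> \<tau>" "g s \<le> 0" using \<open>Inf Z \<in> Z\<close> unfolding s_def Z_def by auto
  have before: "0 < g r" if "t \<le> r" "r < s" for r
  proof (rule ccontr)
    assume "\<not> 0 < g r"
    then have "r \<in> Z" using that s unfolding Z_def by auto
    then have "s \<le> r" unfolding s_def using \<open>bdd_below Z\<close> cInf_lower by blast
    then show False using that by simp
  qed
  have ts: "t < s" using s gt by (metis le_less not_less)
  define w where "w = S s \<tau> v"
  have Sw: "S r s w = S r \<tau> v" if "t \<le> r" "r \<le> s" for r
    unfolding w_def using S_compose[of r s \<tau> v] that t s by simp
  have "w \<noteq> 0"
  proof
    assume "w = 0"
    then have "S t \<tau> v = 0" using Sw[of t] ts by simp
    then show False using gt functionals_zero[OF t(1)] unfolding g_def by simp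
  qed
  have s0: "0 \<le> s" using t ts by simp
  have Im_pos: "0 < Im s w"
  proof (rule ccontr)
    assume "\<not> 0 < Im s w"
    then have "Im s w = 0" using nonneg(1)[OF s0, of w] by simp
    moreover from this have "Ip s w \<le> 0" using s(3) unfolding g_def w_def by simp
    ultimately show False using eq_zero_if_functionals_zero[OF s0] \<open>w \<noteq> 0\<close> by blast
  qed
  have "0 < h s"
  proof -
    have "Ip s w \<le> c * Im s w" using s(3) unfolding g_def w_def by simp
    also have "\<dots> < c4 * Im s w" using c Im_pos by simp
    finally show ?thesis unfolding h_def w_def by simp
  qed
  then obtain \<delta> where \<delta>: "\<delta> > 0" "\<And>r. r \<in> {t..\<tau>} \<Longrightarrow> dist r s < \<delta> \<Longrightarrow> dist (h r) (h s) < h s"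
    using ch s unfolding continuous_on_iff by (metis atLeastAtMost_iff)
  define r where "r = max t (s - \<delta> / 2)"
  have r: "t \<le> r" "r < s" "0 \<le> r" "r \<le> s" using ts \<delta>(1) t unfolding r_def by auto
  have in_c4: "S t' s w \<in> stable_cone Im Ip c4 t'" if t': "t' \<in> {r..s}" for t'
  proof -
    have "dist t' s < \<delta>" "t' \<in> {t..\<tau>}"
      using t' r s \<delta>(1) unfolding r_def dist_real_def by auto
    then have "dist (h t') (h s) < h s" using \<delta>(2) by blast
    then have "0 < h t'" unfolding dist_real_def by auto
    then show ?thesis using Sw[of t'] t' r unfolding h_def stable_cone_def by simp
  qed
  have g0: "0 \<le> g s"
  proof (rule tendsto_lowerbound)
    have "continuous (at s within {t..\<tau>}) g" using cg s
      by (simp add: continuous_on_eq_continuous_within)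
    then have "(g \<longlongrightarrow> g s) (at s within {t..\<tau>})" by (simp add: continuous_within)
    then show "(g \<longlongrightarrow> g s) (at s within {t..<s})"
      by (rule tendsto_within_subset) (use s in auto)
    show "\<forall>\<^sub>F x in at s within {t..<s}. 0 \<le> g x"
      unfolding eventually_at_filter using before
        by (intro always_eventually) (auto intro: less_imp_le)
    show "at s within {t..<s} \<noteq> bot" using ts by (simp add: trivial_limit_within)
  qed
  have in_c3: "S t' s w \<in> unstable_cone Im Ip c3 t'" if t': "t' \<in> {r..s}" for t'
  proof -
    have t'0: "0 \<le> t'" using t' r by simp
    have "0 \<le> g t'" using before[of t'] t' r g0 by (cases "t' = s") auto
    then have "c * Im t' (S t' s w) \<le> Ip t' (S t' s w)"
      using Sw[of t'] t' r unfolding g_def by simp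
    moreover have "c3 * Im t' (S t' s w) \<le> c * Im t' (S t' s w)"
      using c(1) nonneg(1)[OF t'0] by (rule mult_right_mono)
    ultimately show ?thesis unfolding unstable_cone_def by simp
  qed
  have I1: "Im s w \<le> exp (lam * (s - r)) * Im r (S r s w)"
    by (rule growth[OF r(3,4) in_c4])
  have I2: "exp (mu * (s - r)) * Ip r (S r s w) \<le> Ip s w"
    by (rule decay[OF r(3,4) in_c3])
  have I3: "c * Im r (S r s w) < Ip r (S r s w)"
    using before[OF r(1,2)] Sw[OF r(1,4)] unfolding g_def by simp
  have "c * Im s w \<le> c * (exp (lam * (s - r)) * Im r (S r s w))"
    using I1 c_pos by simp
  also have "\<dots> \<le> c * (exp (mu * (s - r)) * Im r (S r s w))"
    using c_pos exponents r nonneg(1)[OF r(3)]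
    by (intro mult_left_mono mult_right_mono) (auto intro: mult_right_mono)
  also have "\<dots> < exp (mu * (s - r)) * Ip r (S r s w)" using I3 by simp
  also have "\<dots> \<le> Ip s w" by (rule I2)
  also have "\<dots> \<le> c * Im s w" using s(3) unfolding g_def w_def by simp
  finally show False by simp
qed

lemma stable_cone_growth:
  assumes t: "0 \<le> t" "t \<le> \<tau>" and c: "c3 \<le> c" "c < c4" and v: "v \<in> stable_cone Im Ip c \<tau>"
  shows "Im \<tau> v \<le> exp (lam * (\<tau> - t)) * Im t (S t \<tau> v)"
proof (rule growth[OF t])
  fix t' assume "t' \<in> {t..\<tau>}"
  then show "S t' \<tau> v \<in> stable_cone Im Ip c4 t'"
    using stable_cone_invariant[OF c _ _ v, of t'] stable_cone_mono[of t' c c4] t c by auto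
qed

text \<open>
  Otherwise \<open>v\<close> would lie in a stable cone of some opening strictly below \<open>c4\<close>, and growth would
  propagate \<open>Im > 0\<close> from \<open>v\<close> to its image at time \<open>0\<close>.
\<close>
lemma kernel_orbit_in_unstable_cone:
  assumes t: "0 \<le> t" and z: "Im 0 (S 0 t v) = 0"
  shows "v \<in> unstable_cone Im Ip c4 t"
proof (rule ccontr)
  assume "v \<notin> unstable_cone Im Ip c4 t"
  then have lt: "Ip t v < c4 * Im t v" unfolding unstable_cone_def by simp
  have pos_Im: "0 < Im t v"
  proof (rule ccontr)
    assume "\<not> 0 < Im t v"
    then have "Im t v = 0" using nonneg(1)[OF t, of v] by simp
    then show False using lt nonneg(2)[OF t, of v] by simp
  qed
  define c where "c = max c3 (Ip t v / Im t v)"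
  have "Ip t v / Im t v < c4" using lt pos_Im by (simp add: divide_simps)
  then have c: "c3 \<le> c" "c < c4" using cone_gap unfolding c_def by auto
  have "Ip t v / Im t v \<le> c" unfolding c_def by simp
  then have "v \<in> stable_cone Im Ip c t"
    unfolding stable_cone_def using pos_Im by (simp add: divide_simps)
  from stable_cone_growth[OF order_refl t c this] z pos_Im show False by simp
qed

text \<open>
  Relative to the norm, the seminorm given by \<open>\<alpha>\<close> is at least \<open>c1 * c2 / (1 + c3)\<close> on the stable
  cone and at most \<open>1 / (c1 * c2 * c4)\<close> on the unstable cone. The gap condition says that the
  difference of these two numbers is positive. The numerator collects the contributions of \<open>s + u\<close>
  to the seminorms of \<open>s + u\<close> and of \<open>u\<close>.
\<close>
definition splitting_const where
  "splitting_const = (1 / (c1 * c2)) * (1 + 1 / c4) / (c1 * c2 / (1 + c3) - 1 / (c1 * c2 * c4))"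

lemma c4_pos: "0 < c4" using pos cone_gap by linarith

lemma splitting_denominator_pos: "0 < c1 * c2 / (1 + c3) - 1 / (c1 * c2 * c4)"
proof -
  define a where "a = c1 * c2"
  have "0 < a" "0 < 1 + c3" using pos unfolding a_def by auto
  moreover have "1 + c3 < a * (a * c4)"
    using cone_gap(2) unfolding a_def[symmetric] by (simp add: power2_eq_square mult.assoc)
  ultimately have "1 / (a * c4) < a / (1 + c3)"
    using c4_pos by (simp add: pos_divide_less_eq pos_less_divide_eq)
  then show ?thesis unfolding a_def by simp
qed

lemma splitting_const_nonneg: "0 \<le> splitting_const"
  unfolding splitting_const_def using splitting_denominator_pos c4_pos pos by simp

lemma max_abs_pairing_nonneg: "0 \<le> max_abs_pairing \<alpha> K t v"
  unfolding max_abs_pairing_def by (intro Max_ge) auto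

lemma max_abs_pairing_split:
  "max_abs_pairing \<alpha> K t s \<le> max_abs_pairing \<alpha> K t (s + u) + max_abs_pairing \<alpha> K t u"
proof -
  have "\<bar>\<alpha> k t s\<bar> \<le> max_abs_pairing \<alpha> K t (s + u) + max_abs_pairing \<alpha> K t u" if "k \<in> {1..K}" for k
  proof -
    have "\<bar>\<alpha> k t (s + u)\<bar> \<le> max_abs_pairing \<alpha> K t (s + u)" "\<bar>\<alpha> k t u\<bar> \<le> max_abs_pairing \<alpha> K t u"
      unfolding max_abs_pairing_def by (rule Max_ge; use that in blast)+
    moreover have "\<bar>\<alpha> k t s\<bar> \<le> \<bar>\<alpha> k t (s + u)\<bar> + \<bar>\<alpha> k t u\<bar>" by (simp add: blinfun.add_right)
    ultimately show ?thesis by linarith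
  qed
  then show ?thesis
    unfolding max_abs_pairing_def[of \<alpha> K t s] using max_abs_pairing_nonneg
    by (intro Max.boundedI) auto
qed

lemma Im_le_norm: "0 \<le> t \<Longrightarrow> Im t v \<le> norm v / c1"
  and Ip_le_norm: "0 \<le> t \<Longrightarrow> Ip t v \<le> norm v / c1"
  using norm_equiv(2)[of t v] nonneg[of t v] by auto

lemma norm_le_Im_in_stable_cone:
  assumes "0 \<le> t" "v \<in> stable_cone Im Ip c3 t"
  shows "norm v \<le> (1 + c3) / c1 * Im t v"
proof -
  have "c1 * norm v \<le> (1 + c3) * Im t v"
    using norm_equiv(1)[OF assms(1), of v] assms(2) unfolding stable_cone_def
    by (simp add: algebra_simps)
  then show ?thesis using pos(1) by (simp add: field_simps)
qed

lemma norm_le_Ip_in_unstable_cone: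
  assumes "0 \<le> t" "v \<in> unstable_cone Im Ip c3 t"
  shows "norm v \<le> (1 + 1 / c3) / c1 * Ip t v"
proof -
  have "Im t v \<le> 1 / c3 * Ip t v"
    using assms(2) pos(3) unfolding unstable_cone_def by (simp add: field_simps)
  then have "c1 * norm v \<le> (1 + 1 / c3) * Ip t v"
    using norm_equiv(1)[OF assms(1), of v] by (simp add: algebra_simps)
  then show ?thesis using pos(1) by (simp add: field_simps)
qed

text \<open>
  If \<open>s + u\<close> were small compared with \<open>s\<close>, then \<open>u\<close> would be close to \<open>- s\<close>. The seminorm given
  by \<open>\<alpha>\<close> is large on \<open>s\<close> and small on \<open>u\<close>, which rules this out. The functional \<open>Im\<close> itself need
  not be subadditive; replacing it by the seminorm is what makes the triangle inequality available.
\<close>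
lemma splitting_bound:
  assumes t: "0 \<le> t" and s: "s \<in> stable_cone Im Ip c3 t" and u: "u \<in> unstable_cone Im Ip c4 t"
  shows "norm s \<le> splitting_const * norm (s + u)"
proof -
  define M where "M = max_abs_pairing \<alpha> K t"
  define d where "d = c1 * c2 / (1 + c3) - 1 / (c1 * c2 * c4)"
  define b where "b = (1 / (c1 * c2)) * (1 + 1 / c4)"
  have M_le: "M v \<le> Im t v / c2" for v
    using seminorm_equiv(1)[OF t, of v] pos unfolding M_def by (simp add: field_simps)
  have "norm s \<le> (1 + c3) / c1 * (1 / c2 * M s)"
    using norm_le_Im_in_stable_cone[OF t s] seminorm_equiv(2)[OF t, of s] pos
      mult_left_mono[of "Im t s" "1 / c2 * M s" "(1 + c3) / c1"] unfolding M_def by simp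
  then have Ms: "c1 * c2 / (1 + c3) * norm s \<le> M s" using pos by (simp add: field_simps)
  have "Im t u \<le> Ip t u / c4" using u c4_pos unfolding unstable_cone_def by (simp add: field_simps)
  also have "\<dots> \<le> norm u / c1 / c4"
    by (rule divide_right_mono[OF Ip_le_norm[OF t]]) (use c4_pos in simp)
  finally have "Im t u / c2 \<le> norm u / c1 / c4 / c2"
    using pos by (intro divide_right_mono) auto
  then have "M u \<le> norm u / c1 / c4 / c2" using M_le[of u] by simp
  also have "\<dots> = 1 / (c1 * c2 * c4) * norm u" by simp
  also have "\<dots> \<le> 1 / (c1 * c2 * c4) * (norm (s + u) + norm s)"
    using pos c4_pos norm_triangle_ineq4[of "s + u" s] by (intro mult_left_mono) auto
  finally have Mu: "M u \<le> 1 / (c1 * c2 * c4) * (norm (s + u) + norm s)" .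
  have "Im t (s + u) / c2 \<le> norm (s + u) / c1 / c2"
    using Im_le_norm[OF t, of "s + u"] pos by (intro divide_right_mono) auto
  then have Mv: "M (s + u) \<le> 1 / (c1 * c2) * norm (s + u)" using M_le[of "s + u"] by simp
  have "M s \<le> M (s + u) + M u" unfolding M_def by (rule max_abs_pairing_split)
  then have "d * norm s \<le> (1 / (c1 * c2) + 1 / (c1 * c2 * c4)) * norm (s + u)"
    using Ms Mu Mv unfolding d_def by (simp add: ring_distribs)
  also have "1 / (c1 * c2) + 1 / (c1 * c2 * c4) = b"
    unfolding b_def by (simp add: ring_distribs)
  finally have "norm s \<le> b * norm (s + u) / d"
    using splitting_denominator_pos unfolding d_def[symmetric]
    by (simp add: pos_le_divide_eq mult.commute)
  then show ?thesis unfolding splitting_const_def d_def b_def by simp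
qed

section \<open>The unstable spaces and approximations of the stable spaces\<close>

definition unstable_space :: "real \<Rightarrow> 'a set" where
  "unstable_space t = {v. \<forall>k\<in>{1..K}. \<alpha> k 0 (S 0 t v) = 0}"

lemma subspace_unstable_space: "subspace (unstable_space t)"
  unfolding unstable_space_def subspace_def
  by (simp add: blinfun.add_right blinfun.scaleR_right blinfun.zero_right)

lemma closed_unstable_space: "closed (unstable_space t)"
proof -
  have "unstable_space t = (\<Inter>k\<in>{1..K}. {v. \<alpha> k 0 (S 0 t v) = 0})" unfolding unstable_space_def
    by auto
  moreover have "closed {v. \<alpha> k 0 (S 0 t v) = 0}" for k
    by (intro closed_Collect_eq continuous_intros)
  ultimately show ?thesis by auto
qed

lemma S_in_unstable_space: "0 \<le> t \<Longrightarrow> t \<le> \<tau> \<Longrightarrow> S t \<tau> v \<in> unstable_space t \<longleftrightarrow> v \<in> unstable_space \<tau>"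
  unfolding unstable_space_def by (simp add: S_compose)

lemma unstable_space_in_unstable_cone:
  assumes t: "0 \<le> t" and v: "v \<in> unstable_space t"
  shows "v \<in> unstable_cone Im Ip c4 t"
proof (rule kernel_orbit_in_unstable_cone[OF t])
  have "max_abs_pairing \<alpha> K 0 (S 0 t v) \<le> 0"
    unfolding max_abs_pairing_def using v unfolding unstable_space_def by (intro Max.boundedI) auto
  then have "max_abs_pairing \<alpha> K 0 (S 0 t v) = 0" using max_abs_pairing_nonneg by (rule antisym)
  then show "Im 0 (S 0 t v) = 0"
    using seminorm_equiv(2)[of 0 "S 0 t v"] nonneg(1)[of 0 "S 0 t v"] by simp
qed

lemma unstable_space_decay:
  assumes t: "0 \<le> t" "t \<le> \<tau>" and v: "v \<in> unstable_space \<tau>"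
  shows "norm (S t \<tau> v) \<le> (1 + 1 / c3) / c1\<^sup>2 * exp (mu * (t - \<tau>)) * norm v"
proof -
  have cone: "S t' \<tau> v \<in> unstable_cone Im Ip c3 t'" if "t' \<in> {t..\<tau>}" for t'
  proof -
    have t': "0 \<le> t'" "t' \<le> \<tau>" using that t by auto
    have "c3 * Im t' (S t' \<tau> v) \<le> c4 * Im t' (S t' \<tau> v)"
      using cone_gap(1) nonneg(1)[OF t'(1)] by (intro mult_right_mono) auto
    then show ?thesis
      using unstable_space_in_unstable_cone[OF t'(1), of "S t' \<tau> v"] S_in_unstable_space[OF t'] v
      unfolding unstable_cone_def by auto
  qed
  have "exp (mu * (\<tau> - t)) * Ip t (S t \<tau> v) \<le> Ip \<tau> v" by (rule decay[OF t cone])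
  also have "\<dots> \<le> norm v / c1" using Ip_le_norm[of \<tau> v] t by simp
  finally have "exp (mu * (t - \<tau>)) * (exp (mu * (\<tau> - t)) * Ip t (S t \<tau> v))
      \<le> exp (mu * (t - \<tau>)) * (norm v / c1)"
    by (rule mult_left_mono) simp
  moreover have "exp (mu * (t - \<tau>)) * exp (mu * (\<tau> - t)) = 1"
    unfolding exp_add[symmetric] by (simp add: algebra_simps)
  ultimately have "Ip t (S t \<tau> v) \<le> exp (mu * (t - \<tau>)) * (norm v / c1)"
    by (simp add: mult.assoc[symmetric])
  then have "(1 + 1 / c3) / c1 * Ip t (S t \<tau> v)
      \<le> (1 + 1 / c3) / c1 * (exp (mu * (t - \<tau>)) * (norm v / c1))"
    using pos by (intro mult_left_mono) auto
  moreover have "norm (S t \<tau> v) \<le> (1 + 1 / c3) / c1 * Ip t (S t \<tau> v)"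
    using norm_le_Ip_in_unstable_cone[OF t(1) cone[of t]] t by simp
  ultimately show ?thesis by (simp add: power2_eq_square mult_ac)
qed

text \<open>
  This single bound yields injectivity of the evolution on subspaces of the stable cone and the
  exponential estimate for its inverse.
\<close>
lemma stable_cone_norm_growth:
  assumes t: "0 \<le> t" "t \<le> \<tau>" and v: "v \<in> stable_cone Im Ip c3 \<tau>"
  shows "norm v \<le> (1 + c3) / c1\<^sup>2 * exp (lam * (\<tau> - t)) * norm (S t \<tau> v)"
proof -
  have "Im \<tau> v \<le> exp (lam * (\<tau> - t)) * Im t (S t \<tau> v)"
    by (rule stable_cone_growth[OF t order_refl cone_gap(1) v])
  also have "\<dots> \<le> exp (lam * (\<tau> - t)) * (norm (S t \<tau> v) / c1)"
    by (intro mult_left_mono Im_le_norm t) simp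
  finally have "(1 + c3) / c1 * Im \<tau> v
      \<le> (1 + c3) / c1 * (exp (lam * (\<tau> - t)) * (norm (S t \<tau> v) / c1))"
    using pos by (intro mult_left_mono) auto
  moreover have "norm v \<le> (1 + c3) / c1 * Im \<tau> v"
    using norm_le_Im_in_stable_cone[OF _ v] t by simp
  ultimately show ?thesis by (simp add: power2_eq_square mult_ac)
qed

definition cone_subspace :: "real \<Rightarrow> 'a set" where
  "cone_subspace \<tau> = (SOME V. subspace_of_dimension V K \<and> V \<subseteq> stable_cone Im Ip c3 \<tau>)"

lemma cone_subspace:
  assumes "0 \<le> \<tau>"
  shows "subspace_of_dimension (cone_subspace \<tau>) K" "cone_subspace \<tau> \<subseteq> stable_cone Im Ip c3 \<tau>"
  using someI_ex[OF subspace_in_cone[OF assms]] unfolding cone_subspace_def by auto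

text \<open>
  The subspace chosen at time \<open>\<tau>\<close>, evolved back to time \<open>t\<close>; for large \<open>\<tau>\<close> it approximates the
  stable space.
\<close>
definition evolved_space :: "real \<Rightarrow> real \<Rightarrow> 'a set" where
  "evolved_space \<tau> t = S t \<tau> ` cone_subspace \<tau>"

lemma evolved_space_in_stable_cone:
  assumes "0 \<le> t" "t \<le> \<tau>" shows "evolved_space \<tau> t \<subseteq> stable_cone Im Ip c3 t"
  using stable_cone_invariant[OF order_refl cone_gap(1) assms] cone_subspace(2)[of \<tau>] assms
  unfolding evolved_space_def by auto

lemma subspace_evolved_space: "0 \<le> \<tau> \<Longrightarrow> subspace (evolved_space \<tau> t)"
  unfolding evolved_space_def
  by (intro linear_subspace_image linear_blinfun subspace_of_dimension_subspace[OF cone_subspace(1)])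

lemma S_in_evolved_space: "0 \<le> s \<Longrightarrow> s \<le> t \<Longrightarrow> t \<le> \<tau> \<Longrightarrow> v \<in> evolved_space \<tau> t \<Longrightarrow> S s t v \<in> evolved_space \<tau> s"
  unfolding evolved_space_def using S_compose by auto

lemma stable_cone_Int_unstable_space:
  assumes "0 \<le> t" "s \<in> stable_cone Im Ip c3 t" "s \<in> unstable_space t" shows "s = 0"
proof -
  have "- s \<in> unstable_cone Im Ip c4 t"
    using unstable_space_in_unstable_cone[OF assms(1)] assms(3) subspace_neg[OF subspace_unstable_space] by blast
  from splitting_bound[OF assms(1,2) this] show ?thesis by simp
qed

text \<open>
  Evolving back does not lower the dimension \<open>K\<close>, and the cone bounds exclude a nonzero vector in common with
  the unstable space, which is cut out by \<open>K\<close> functionals.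
\<close>
lemma evolved_space_complements_unstable_space:
  assumes t: "0 \<le> t" "t \<le> \<tau>"
  shows "\<exists>!w. w \<in> evolved_space \<tau> t \<and> v - w \<in> unstable_space t"
proof -
  have \<tau>: "0 \<le> \<tau>" using t by simp
  have dim: "subspace_of_dimension (evolved_space \<tau> t) K"
    unfolding evolved_space_def
  proof (rule subspace_of_dimension_injective_image[OF cone_subspace(1)[OF \<tau>] linear_blinfun])
    fix v assume v: "v \<in> cone_subspace \<tau>" "S t \<tau> v = 0"
    then have "norm v \<le> 0" using stable_cone_norm_growth[OF t, of v] cone_subspace(2)[OF \<tau>] by auto
    then show "v = 0" by simp
  qed
  have trivial: "w = 0" if "w \<in> evolved_space \<tau> t" "w \<in> unstable_space t" for w
    using stable_cone_Int_unstable_space[OF t(1) _ that(2)] evolved_space_in_stable_cone[OF t] that(1)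
      by blast
  have "\<exists>w\<in>evolved_space \<tau> t. \<forall>k\<in>{1..K}. \<alpha> k 0 (S 0 t w) = \<alpha> k 0 (S 0 t v)"
  proof (rule transversal_represents_functionals[OF _ dim])
    show "linear (\<lambda>w. \<alpha> k 0 (S 0 t w))" for k
      by (rule linearI) (simp_all add: blinfun.add_right blinfun.scaleR_right)
  next
    fix w assume "w \<in> evolved_space \<tau> t" "\<forall>k\<in>{1..K}. \<alpha> k 0 (S 0 t w) = 0"
    then show "w = 0" using trivial unfolding unstable_space_def by blast
  qed
  then obtain w where w: "w \<in> evolved_space \<tau> t" "v - w \<in> unstable_space t"
    unfolding unstable_space_def by (auto simp: blinfun.diff_right)
  show ?thesis
  proof (rule ex1I[of _ w])
    fix w' assume w': "w' \<in> evolved_space \<tau> t \<and> v - w' \<in> unstable_space t"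
    have "w' - w \<in> evolved_space \<tau> t" using w w' subspace_diff[OF subspace_evolved_space[OF \<tau>]] by blast
    moreover have "(v - w) - (v - w') \<in> unstable_space t"
      using w w' subspace_diff[OF subspace_unstable_space] by blast
    ultimately show "w' = w" using trivial[of "w' - w"] by simp
  qed (use w in blast)
qed

definition approx_proj :: "real \<Rightarrow> real \<Rightarrow> 'a \<Rightarrow> 'a" where
  "approx_proj \<tau> t v = (THE w. w \<in> evolved_space \<tau> t \<and> v - w \<in> unstable_space t)"

lemma approx_proj:
  assumes "0 \<le> t" "t \<le> \<tau>"
  shows "approx_proj \<tau> t v \<in> evolved_space \<tau> t" "v - approx_proj \<tau> t v \<in> unstable_space t"
  using theI'[OF evolved_space_complements_unstable_space[OF assms]] unfolding approx_proj_def by auto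

lemma approx_proj_unique:
  assumes "0 \<le> t" "t \<le> \<tau>" "w \<in> evolved_space \<tau> t" "v - w \<in> unstable_space t"
  shows "approx_proj \<tau> t v = w"
  using evolved_space_complements_unstable_space[OF assms(1,2)] approx_proj[OF assms(1,2)] assms(3,4)
    by blast

lemma linear_approx_proj:
  assumes t: "0 \<le> t" "t \<le> \<tau>" shows "linear (approx_proj \<tau> t)"
proof (rule linearI)
  have \<tau>: "0 \<le> \<tau>" using t by simp
  fix v w r
  show "approx_proj \<tau> t (v + w) = approx_proj \<tau> t v + approx_proj \<tau> t w"
    using subspace_add[OF subspace_evolved_space[OF \<tau>] approx_proj(1)[OF t, of v] approx_proj(1)[OF t, of w]]
      subspace_add[OF subspace_unstable_space approx_proj(2)[OF t, of v] approx_proj(2)[OF t, of w]]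
    by (intro approx_proj_unique t) (auto simp: algebra_simps)
  show "approx_proj \<tau> t (r *\<^sub>R v) = r *\<^sub>R approx_proj \<tau> t v"
    using subspace_scale[OF subspace_evolved_space[OF \<tau>] approx_proj(1)[OF t, of v]]
      subspace_scale[OF subspace_unstable_space approx_proj(2)[OF t, of v]]
    by (intro approx_proj_unique t) (auto simp: scaleR_diff_right)
qed

lemma approx_proj_bound:
  assumes t: "0 \<le> t" "t \<le> \<tau>" shows "norm (approx_proj \<tau> t v) \<le> splitting_const * norm v"
  using splitting_bound[OF t(1), of "approx_proj \<tau> t v" "v - approx_proj \<tau> t v"]
    evolved_space_in_stable_cone[OF t] approx_proj[OF t, of v] unstable_space_in_unstable_cone[OF t(1)]
      by auto

lemma approx_proj_commute:
  assumes "0 \<le> s" "s \<le> t" "t \<le> \<tau>"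
  shows "approx_proj \<tau> s (S s t v) = S s t (approx_proj \<tau> t v)"
proof (rule approx_proj_unique)
  have t: "0 \<le> t" using assms by simp
  show "S s t (approx_proj \<tau> t v) \<in> evolved_space \<tau> s"
    using S_in_evolved_space approx_proj(1)[OF t assms(3)] assms by blast
  show "S s t v - S s t (approx_proj \<tau> t v) \<in> unstable_space s"
    using S_in_unstable_space[OF assms(1,2), of "v - approx_proj \<tau> t v"] approx_proj(2)[OF t assms(3)]
    by (simp add: blinfun.diff_right)
qed (use assms in auto)

section \<open>The stable projection as a limit\<close>

definition cauchy_const where
  "cauchy_const = (1 + 1 / c3) / c1\<^sup>2 * ((1 + splitting_const) * ((1 + c3) / c1\<^sup>2)) * splitting_const"

lemma cauchy_const_nonneg: "0 \<le> cauchy_const"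
  unfolding cauchy_const_def using pos splitting_const_nonneg by simp

text \<open>
  Write the component of \<open>v\<close> in the evolved space from \<open>\<tau>\<close> as \<open>S t \<tau> w\<close> and split \<open>w\<close> at time \<open>\<tau>\<close>
  with respect to the evolved space from \<open>\<sigma>\<close>. Since the evolution respects the splittings, the two
  projections of \<open>v\<close> differ by \<open>S t \<tau> q\<close>, where \<open>q\<close> is the unstable part of \<open>w\<close>. The norm of
  \<open>w\<close> exceeds that of \<open>S t \<tau> w\<close> at most by a multiple of \<open>exp (lam * (\<tau> - t))\<close>, whereas \<open>q\<close>
  decays with exponent \<open>mu\<close>.
\<close>
lemma approx_proj_diff_bound:
  assumes t: "0 \<le> t" "t \<le> \<tau>" and \<sigma>: "\<tau> \<le> \<sigma>"
  shows "norm (approx_proj \<tau> t v - approx_proj \<sigma> t v) \<le> cauchy_const * norm v * exp (- (mu - lam) * (\<tau> - t))"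
proof -
  have \<tau>: "0 \<le> \<tau>" and t\<sigma>: "t \<le> \<sigma>" using t \<sigma> by auto
  define D where "D = (1 + 1 / c3) / c1\<^sup>2"
  define E where "E = (1 + c3) / c1\<^sup>2"
  have DE: "0 \<le> D" "0 \<le> E" unfolding D_def E_def using pos by auto
  obtain w where w: "w \<in> cone_subspace \<tau>" "approx_proj \<tau> t v = S t \<tau> w"
    using approx_proj(1)[OF t, of v] unfolding evolved_space_def by blast
  define q where "q = w - approx_proj \<sigma> \<tau> w"
  have q: "q \<in> unstable_space \<tau>" unfolding q_def by (rule approx_proj(2)[OF \<tau> \<sigma>])
  have "approx_proj \<sigma> t v = S t \<tau> (approx_proj \<sigma> \<tau> w)"
  proof (rule approx_proj_unique[OF t(1) t\<sigma>])
    show "S t \<tau> (approx_proj \<sigma> \<tau> w) \<in> evolved_space \<sigma> t"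
      using S_in_evolved_space[OF t \<sigma>] approx_proj(1)[OF \<tau> \<sigma>] by blast
    have "(v - approx_proj \<tau> t v) + S t \<tau> q \<in> unstable_space t"
      using approx_proj(2)[OF t] q S_in_unstable_space[OF t] subspace_add[OF subspace_unstable_space] by blast
    then show "v - S t \<tau> (approx_proj \<sigma> \<tau> w) \<in> unstable_space t" unfolding q_def w(2)
      by (simp add: blinfun.diff_right)
  qed
  then have "approx_proj \<tau> t v - approx_proj \<sigma> t v = S t \<tau> q" unfolding w(2) q_def
    by (simp add: blinfun.diff_right)
  then have "norm (approx_proj \<tau> t v - approx_proj \<sigma> t v) \<le> D * exp (mu * (t - \<tau>)) * norm q"
    using unstable_space_decay[OF t q] unfolding D_def by simp
  also have "\<dots> \<le> D * exp (mu * (t - \<tau>)) *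
      ((1 + splitting_const) * (E * exp (lam * (\<tau> - t)) * (splitting_const * norm v)))"
  proof (intro mult_left_mono)
    have "norm q \<le> (1 + splitting_const) * norm w"
      unfolding q_def
        using norm_triangle_ineq4[of w "approx_proj \<sigma> \<tau> w"] approx_proj_bound[OF \<tau> \<sigma>, of w]
      by (simp add: algebra_simps)
    moreover have "norm w \<le> E * exp (lam * (\<tau> - t)) * norm (approx_proj \<tau> t v)"
      using stable_cone_norm_growth[OF t, of w] cone_subspace(2)[OF \<tau>] w unfolding E_def by auto
    moreover have "E * exp (lam * (\<tau> - t)) * norm (approx_proj \<tau> t v)
        \<le> E * exp (lam * (\<tau> - t)) * (splitting_const * norm v)"
      using approx_proj_bound[OF t] DE by (intro mult_left_mono) auto
    ultimately show "norm q
        \<le> (1 + splitting_const) * (E * exp (lam * (\<tau> - t)) * (splitting_const * norm v))"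
      using splitting_const_nonneg
      by (meson add_nonneg_nonneg mult_left_mono order_trans zero_le_one)
  qed (use DE in simp)
  also have "\<dots> = cauchy_const * norm v * (exp (mu * (t - \<tau>)) * exp (lam * (\<tau> - t)))"
    unfolding cauchy_const_def D_def E_def by (simp add: mult_ac)
  also have "exp (mu * (t - \<tau>)) * exp (lam * (\<tau> - t)) = exp (- (mu - lam) * (\<tau> - t))"
    unfolding exp_add[symmetric] by (simp add: algebra_simps)
  finally show ?thesis .
qed

text \<open>
  The limit is taken along integer times \<open>\<tau>\<close>; those before \<open>t\<close>, for which the approximations are
  unspecified, do not affect it.
\<close>
definition stable_proj :: "real \<Rightarrow> 'a \<Rightarrow> 'a" where
  "stable_proj t v = lim (\<lambda>n. approx_proj (real n) t v)"

lemma eventually_later: "\<forall>\<^sub>F n in sequentially. t \<le> real n"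
  using filterlim_real_sequentially by (simp add: filterlim_at_top)

lemma stable_proj_limit:
  assumes t: "0 \<le> t" shows "(\<lambda>n. approx_proj (real n) t v) \<longlonglongrightarrow> stable_proj t v"
proof -
  have "(\<lambda>n. cauchy_const * norm v * exp (- (mu - lam) * (real n - t))) \<longlonglongrightarrow> cauchy_const * norm v * 0"
  proof (intro tendsto_mult_left filterlim_compose[OF exp_at_bot])
    have "filterlim (\<lambda>n. real n - t) at_top sequentially"
      using filterlim_tendsto_add_at_top[OF tendsto_const filterlim_real_sequentially, of "- t"]
      by (simp add: add.commute)
    then show "filterlim (\<lambda>n. - (mu - lam) * (real n - t)) at_bot sequentially"
      using exponents by (intro filterlim_tendsto_neg_mult_at_bot[OF tendsto_const]) auto
  qed
  then have lim0: "(\<lambda>n. cauchy_const * norm v * exp (- (mu - lam) * (real n - t))) \<longlonglongrightarrow> 0" by simp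
  have "Cauchy (\<lambda>n. approx_proj (real n) t v)"
  proof (rule CauchyI')
    fix e :: real assume "0 < e"
    then have "\<forall>\<^sub>F n in sequentially. cauchy_const * norm v * exp (- (mu - lam) * (real n - t)) < e"
      using order_tendstoD(2)[OF lim0] by blast
    then have "\<forall>\<^sub>F n in sequentially.
        cauchy_const * norm v * exp (- (mu - lam) * (real n - t)) < e \<and> t \<le> real n"
      using eventually_later eventually_conj by blast
    then obtain N where N: "\<And>n. n \<ge> N \<Longrightarrow>
        cauchy_const * norm v * exp (- (mu - lam) * (real n - t)) < e \<and> t \<le> real n"
      unfolding eventually_sequentially by blast
    have "norm (approx_proj (real m) t v - approx_proj (real n) t v) < e" if "m \<ge> N" "n > m" for m n
      using approx_proj_diff_bound[OF t, of "real m" "real n" v] N[OF that(1)] that(2) by fastforce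
    then show "\<exists>M. \<forall>m\<ge>M. \<forall>n>m. dist (approx_proj (real m) t v) (approx_proj (real n) t v) < e"
      unfolding dist_norm by blast
  qed
  then show ?thesis unfolding stable_proj_def
    by (simp add: Cauchy_convergent_iff convergent_LIMSEQ_iff)
qed

lemma stable_proj_in_stable_cone:
  assumes t: "0 \<le> t" shows "stable_proj t v \<in> stable_cone Im Ip c3 t"
proof -
  have "Ip t (stable_proj t v) \<le> c3 * Im t (stable_proj t v)"
  proof (rule tendsto_le[OF sequentially_bot])
    show "(\<lambda>n. c3 * Im t (approx_proj (real n) t v)) \<longlonglongrightarrow> c3 * Im t (stable_proj t v)"
      by (intro tendsto_mult_left tendsto_functional t stable_proj_limit)
    show "(\<lambda>n. Ip t (approx_proj (real n) t v)) \<longlonglongrightarrow> Ip t (stable_proj t v)"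
      by (intro tendsto_functional t stable_proj_limit)
    show "\<forall>\<^sub>F n in sequentially. Ip t (approx_proj (real n) t v) \<le> c3 * Im t (approx_proj (real n) t v)"
      using eventually_later[of t]
    proof eventually_elim
      case (elim n)
      then show ?case using evolved_space_in_stable_cone[OF t elim] approx_proj(1)[OF t elim]
        unfolding stable_cone_def by blast
    qed
  qed
  then show ?thesis unfolding stable_cone_def by simp
qed

lemma diff_stable_proj_in_unstable_space:
  assumes t: "0 \<le> t" shows "v - stable_proj t v \<in> unstable_space t"
proof (rule Lim_in_closed_set[OF closed_unstable_space _ sequentially_bot])
  show "(\<lambda>n. v - approx_proj (real n) t v) \<longlonglongrightarrow> v - stable_proj t v"
    by (intro tendsto_intros stable_proj_limit t)
  show "\<forall>\<^sub>F n in sequentially. v - approx_proj (real n) t v \<in> unstable_space t"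
    using eventually_later[of t] by eventually_elim (rule approx_proj(2)[OF t])
qed

lemma stable_proj_bound:
  assumes t: "0 \<le> t" shows "norm (stable_proj t v) \<le> splitting_const * norm v"
proof (rule tendsto_upperbound[OF tendsto_norm[OF stable_proj_limit[OF t]] _ sequentially_bot])
  show "\<forall>\<^sub>F n in sequentially. norm (approx_proj (real n) t v) \<le> splitting_const * norm v"
    using eventually_later[of t] by eventually_elim (rule approx_proj_bound[OF t])
qed

lemma linear_stable_proj:
  assumes t: "0 \<le> t" shows "linear (stable_proj t)"
proof (rule linearI)
  fix v w r
  show "stable_proj t (v + w) = stable_proj t v + stable_proj t w"
  proof (rule LIMSEQ_unique[OF stable_proj_limit[OF t]])
    have "\<forall>\<^sub>F n in sequentially. approx_proj (real n) t v + approx_proj (real n) t w = approx_proj (real n) t (v + w)"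
      using eventually_later[of t]
        by eventually_elim (simp add: linear_add[OF linear_approx_proj[OF t]])
    then show "(\<lambda>n. approx_proj (real n) t (v + w)) \<longlonglongrightarrow> stable_proj t v + stable_proj t w"
      by (rule Lim_transform_eventually[rotated]) (intro tendsto_intros stable_proj_limit t)
  qed
  show "stable_proj t (r *\<^sub>R v) = r *\<^sub>R stable_proj t v"
  proof (rule LIMSEQ_unique[OF stable_proj_limit[OF t]])
    have "\<forall>\<^sub>F n in sequentially. r *\<^sub>R approx_proj (real n) t v = approx_proj (real n) t (r *\<^sub>R v)"
      using eventually_later[of t]
        by eventually_elim (simp add: linear_scale[OF linear_approx_proj[OF t]])
    then show "(\<lambda>n. approx_proj (real n) t (r *\<^sub>R v)) \<longlonglongrightarrow> r *\<^sub>R stable_proj t v"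
      by (rule Lim_transform_eventually[rotated]) (intro tendsto_intros stable_proj_limit t)
  qed
qed

lemma stable_proj_commute:
  assumes t: "0 \<le> t" "t \<le> \<tau>" shows "stable_proj t (S t \<tau> v) = S t \<tau> (stable_proj \<tau> v)"
proof (rule LIMSEQ_unique[OF stable_proj_limit[OF t(1)]])
  have \<tau>: "0 \<le> \<tau>" using t by simp
  have "\<forall>\<^sub>F n in sequentially. S t \<tau> (approx_proj (real n) \<tau> v) = approx_proj (real n) t (S t \<tau> v)"
    using eventually_later[of \<tau>] by eventually_elim (simp add: approx_proj_commute[OF t])
  then show "(\<lambda>n. approx_proj (real n) t (S t \<tau> v)) \<longlonglongrightarrow> S t \<tau> (stable_proj \<tau> v)"
    by (rule Lim_transform_eventually[rotated]) (intro tendsto_intros stable_proj_limit \<tau>)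
qed

lemma stable_proj_eq_zero_iff:
  assumes t: "0 \<le> t" shows "stable_proj t v = 0 \<longleftrightarrow> v \<in> unstable_space t"
proof
  assume "stable_proj t v = 0"
  then show "v \<in> unstable_space t" using diff_stable_proj_in_unstable_space[OF t, of v] by simp
next
  assume v: "v \<in> unstable_space t"
  have "v - (v - stable_proj t v) \<in> unstable_space t"
    by (rule subspace_diff[OF subspace_unstable_space v diff_stable_proj_in_unstable_space[OF t]])
  then show "stable_proj t v = 0"
    using stable_cone_Int_unstable_space[OF t stable_proj_in_stable_cone[OF t, of v]] by simp
qed

lemma stable_proj_eq_if_diff_in_unstable_space:
  assumes "0 \<le> t" "v - w \<in> unstable_space t" shows "stable_proj t v = stable_proj t w"
  using stable_proj_eq_zero_iff[OF assms(1), of "v - w"] assms(2) linear_diff[OF linear_stable_proj[OF assms(1)]] by simp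

definition stable_space :: "real \<Rightarrow> 'a set" where
  "stable_space t = range (stable_proj t)"

lemma stable_proj_stable_space: "0 \<le> t \<Longrightarrow> v \<in> stable_space t \<Longrightarrow> stable_proj t v = v"
  unfolding stable_space_def
    using stable_proj_eq_if_diff_in_unstable_space diff_stable_proj_in_unstable_space
    by (metis imageE)

lemma stable_space_in_stable_cone: "0 \<le> t \<Longrightarrow> stable_space t \<subseteq> stable_cone Im Ip c3 t"
  unfolding stable_space_def using stable_proj_in_stable_cone by blast

text \<open>
  The stable space and the chosen subspace at time \<open>t\<close> complement the same unstable space, so
  the limit projection is an isomorphism between them.
\<close>
lemma dimension_stable_space:
  assumes t: "0 \<le> t" shows "subspace_of_dimension (stable_space t) K"
proof -
  have "subspace_of_dimension (stable_proj t ` cone_subspace t) K"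
  proof (rule subspace_of_dimension_injective_image[OF cone_subspace(1)[OF t] linear_stable_proj[OF t]])
    fix v assume "v \<in> cone_subspace t" "stable_proj t v = 0"
    then show "v = 0"
      using stable_proj_eq_zero_iff[OF t] stable_cone_Int_unstable_space[OF t] cone_subspace(2)[OF t] by blast
  qed
  moreover have "stable_proj t ` cone_subspace t = stable_space t"
  proof
    show "stable_space t \<subseteq> stable_proj t ` cone_subspace t"
    proof
      fix x assume "x \<in> stable_space t"
      then obtain v where "x = stable_proj t v" unfolding stable_space_def by blast
      then have "x = stable_proj t (approx_proj t t v)"
        using stable_proj_eq_if_diff_in_unstable_space[OF t approx_proj(2)[OF t order_refl]] by simp
      moreover have "approx_proj t t v \<in> cone_subspace t"
        using approx_proj(1)[OF t order_refl, of v] t unfolding evolved_space_def by simp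
      ultimately show "x \<in> stable_proj t ` cone_subspace t" by blast
    qed
  qed (auto simp: stable_space_def)
  ultimately show ?thesis by simp
qed

text \<open>
  For surjectivity, a point \<open>x\<close> of the stable space agrees modulo the unstable space with some
  \<open>S t \<tau> w\<close>; projecting and commuting with the evolution gives the preimage.
\<close>
lemma bij_betw_stable_space:
  assumes t: "0 \<le> t" "t \<le> \<tau>" shows "bij_betw (S t \<tau>) (stable_space \<tau>) (stable_space t)"
proof -
  have \<tau>: "0 \<le> \<tau>" using t by simp
  have sub: "subspace (stable_space \<tau>)"
    by (rule subspace_of_dimension_subspace[OF dimension_stable_space[OF \<tau>]])
  have "inj_on (S t \<tau>) (stable_space \<tau>)"
  proof (subst linear_inj_on_iff_eq_0[OF linear_blinfun sub], intro ballI impI)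
    fix v assume "v \<in> stable_space \<tau>" "S t \<tau> v = 0"
    then have "norm v \<le> 0"
      using stable_cone_norm_growth[OF t, of v] stable_space_in_stable_cone[OF \<tau>] by auto
    then show "v = 0" by simp
  qed
  moreover have "S t \<tau> ` stable_space \<tau> = stable_space t"
  proof
    show "S t \<tau> ` stable_space \<tau> \<subseteq> stable_space t" unfolding stable_space_def
      using stable_proj_commute[OF t, symmetric] by auto
    show "stable_space t \<subseteq> S t \<tau> ` stable_space \<tau>"
    proof
      fix x assume x: "x \<in> stable_space t"
      obtain w where w: "approx_proj \<tau> t x = S t \<tau> w" using approx_proj(1)[OF t, of x]
        unfolding evolved_space_def by blast
      have "x = stable_proj t x" using stable_proj_stable_space[OF t(1) x] by simp
      also have "\<dots> = stable_proj t (S t \<tau> w)"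
        using stable_proj_eq_if_diff_in_unstable_space[OF t(1) approx_proj(2)[OF t], of x] w by simp
      also have "\<dots> = S t \<tau> (stable_proj \<tau> w)" by (rule stable_proj_commute[OF t])
      finally show "x \<in> S t \<tau> ` stable_space \<tau>" unfolding stable_space_def by blast
    qed
  qed
  ultimately show ?thesis unfolding bij_betw_def by blast
qed

lemma direct_sum_stable_space_unstable_space:
  assumes t: "0 \<le> t" shows "direct_sum_decomposition (stable_space t) (unstable_space t)"
  unfolding direct_sum_decomposition_def
proof (intro conjI allI)
  show sub: "subspace (stable_space t)"
    by (rule subspace_of_dimension_subspace[OF dimension_stable_space[OF t]])
  show "subspace (unstable_space t)" by (rule subspace_unstable_space)
  show "stable_space t \<inter> unstable_space t = {0}"
    using stable_cone_Int_unstable_space[OF t] stable_space_in_stable_cone[OF t] subspace_0[OF sub] subspace_0[OF subspace_unstable_space]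
    by blast
  fix x
  have "stable_proj t x \<in> stable_space t" unfolding stable_space_def by simp
  moreover have "x = stable_proj t x + (x - stable_proj t x)" by simp
  ultimately show "\<exists>v\<in>stable_space t. \<exists>w\<in>unstable_space t. x = v + w"
    using diff_stable_proj_in_unstable_space[OF t] by blast
qed

theorem dichotomy: "exponential_dichotomy_on S lam mu stable_space unstable_space"
proof -
  define A where "A = splitting_const"
  define D where "D = (1 + 1 / c3) / c1\<^sup>2"
  define E where "E = (1 + c3) / c1\<^sup>2"
  define C where "C = 2 * A + 1 + D + E"
  have nonneg': "0 \<le> A" "0 \<le> D" "0 \<le> E"
    unfolding A_def D_def E_def using splitting_const_nonneg pos by auto
  define \<pi>s where "\<pi>s t = Blinfun (stable_proj t)" for t
  define \<pi>u where "\<pi>u t = id_blinfun - \<pi>s t" for t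
  have \<pi>s: "\<pi>s t v = stable_proj t v" if "0 \<le> t" for t v
  proof -
    have "bounded_linear (stable_proj t)"
      using linear_stable_proj[OF that] stable_proj_bound[OF that]
        unfolding bounded_linear_def bounded_linear_axioms_def
      by (metis mult.commute)
    then show ?thesis unfolding \<pi>s_def by (simp add: bounded_linear_Blinfun_apply)
  qed
  have \<pi>u: "\<pi>u t v = v - stable_proj t v" if "0 \<le> t" for t v
    unfolding \<pi>u_def by (simp add: blinfun.diff_left \<pi>s[OF that])
  have proj: "associated_projections (stable_space t) (unstable_space t) (\<pi>s t) (\<pi>u t)" if "0 \<le> t" for t
    unfolding associated_projections_def
      using \<pi>s[OF that] \<pi>u[OF that] diff_stable_proj_in_unstable_space[OF that]
    by (auto simp: stable_space_def)
  have main: "S t \<tau> o\<^sub>L \<pi>s \<tau> = \<pi>s t o\<^sub>L S t \<tau> \<and> S t \<tau> o\<^sub>L \<pi>u \<tau> = \<pi>u t o\<^sub>L S t \<tau> \<and>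
      norm (\<pi>s t) + norm (\<pi>u t) \<le> C \<and> bij_betw (S t \<tau>) (stable_space \<tau>) (stable_space t) \<and>
      (\<forall>v\<in>stable_space t. norm (inv_into (stable_space \<tau>) (S t \<tau>) v) \<le> C * exp (lam * (\<tau> - t)) * norm v) \<and>
      (\<forall>v\<in>unstable_space \<tau>. norm (S t \<tau> v) \<le> C * exp (mu * (t - \<tau>)) * norm v)"
    if t: "0 \<le> t" "t \<le> \<tau>" for t \<tau>
  proof (intro conjI ballI)
    have \<tau>: "0 \<le> \<tau>" using t by simp
    show "S t \<tau> o\<^sub>L \<pi>s \<tau> = \<pi>s t o\<^sub>L S t \<tau>"
      by (rule blinfun_eqI) (simp add: \<pi>s t \<tau> stable_proj_commute)
    show "S t \<tau> o\<^sub>L \<pi>u \<tau> = \<pi>u t o\<^sub>L S t \<tau>"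
      by (rule blinfun_eqI) (simp add: \<pi>u t \<tau> stable_proj_commute blinfun.diff_right)
    have "norm (\<pi>s t) \<le> A"
      using norm_blinfun_bound[OF nonneg'(1), of "\<pi>s t"] stable_proj_bound[OF t(1)]
      unfolding A_def by (simp add: \<pi>s t)
    moreover have "norm (\<pi>u t) \<le> 1 + norm (\<pi>s t)"
      unfolding \<pi>u_def using norm_triangle_ineq4[of "id_blinfun" "\<pi>s t"]
        norm_blinfun_id_le[where 'a = 'a] by linarith
    ultimately show "norm (\<pi>s t) + norm (\<pi>u t) \<le> C" unfolding C_def using nonneg' by simp
    show bij: "bij_betw (S t \<tau>) (stable_space \<tau>) (stable_space t)"
      by (rule bij_betw_stable_space[OF t])
    show "norm (inv_into (stable_space \<tau>) (S t \<tau>) v) \<le> C * exp (lam * (\<tau> - t)) * norm v" if v: "v \<in> stable_space t" for v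
    proof -
      define w where "w = inv_into (stable_space \<tau>) (S t \<tau>) v"
      have w: "w \<in> stable_space \<tau>" "S t \<tau> w = v"
        unfolding w_def using v bij by (auto simp: bij_betw_def inv_into_into f_inv_into_f)
      have "norm w \<le> E * exp (lam * (\<tau> - t)) * norm v"
        using stable_cone_norm_growth[OF t, of w] w stable_space_in_stable_cone[OF \<tau>]
          unfolding E_def by auto
      also have "\<dots> \<le> C * exp (lam * (\<tau> - t)) * norm v"
        unfolding C_def using nonneg' by (intro mult_right_mono) auto
      finally show ?thesis unfolding w_def .
    qed
    show "norm (S t \<tau> v) \<le> C * exp (mu * (t - \<tau>)) * norm v" if v: "v \<in> unstable_space \<tau>" for v
    proof -
      have "norm (S t \<tau> v) \<le> D * exp (mu * (t - \<tau>)) * norm v"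
        unfolding D_def by (rule unstable_space_decay[OF t v])
      also have "\<dots> \<le> C * exp (mu * (t - \<tau>)) * norm v"
        unfolding C_def using nonneg' by (intro mult_right_mono) auto
      finally show ?thesis .
    qed
  qed
  show ?thesis
    unfolding exponential_dichotomy_on_def
  proof (intro conjI)
    show "lam < mu" by (rule exponents)
    show "\<forall>t\<ge>0. direct_sum_decomposition (stable_space t) (unstable_space t)"
      using direct_sum_stable_space_unstable_space by simp
  qed (intro exI[of _ \<pi>s] exI[of _ \<pi>u] exI[of _ C] conjI allI impI proj main, simp_all)
qed

end

section \<open>The general hypotheses\<close>

theorem theorem3:
  fixes S :: "real \<Rightarrow> real \<Rightarrow> 'a::banach \<Rightarrow>\<^sub>L 'a"
    and Iminus Iplus :: "real \<Rightarrow> 'a \<Rightarrow> real"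
    and \<alpha> :: "nat \<Rightarrow> real \<Rightarrow> 'a \<Rightarrow>\<^sub>L real"
    and c1 c2 c3 c4 lam mu :: real
    and K :: nat
  assumes "backward_evolution_operator S"
    and "\<forall>t\<ge>0. \<forall>v. 0 \<le> Iminus t v \<and> 0 \<le> Iplus t v"
    and "\<forall>t\<ge>0. homogeneous (Iminus t) \<and> homogeneous (Iplus t)"
    and "continuous_on ({0..} \<times> UNIV) (\<lambda>(t, v). Iminus t v)"
    and "continuous_on ({0..} \<times> UNIV) (\<lambda>(t, v). Iplus t v)"
    and "c1 > 0" and "c2 > 0" and "c3 > 0" and "c4 > 0" and "lam < mu"
    and "\<forall>t\<ge>0. \<forall>v. c1 * norm v \<le> Iminus t v + Iplus t v \<and>
                    Iminus t v + Iplus t v \<le> 1 / c1 * norm v"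
    and "\<forall>t\<ge>0. \<forall>v. c2 * max_abs_pairing \<alpha> K t v \<le> Iminus t v \<and>
                    Iminus t v \<le> 1 / c2 * max_abs_pairing \<alpha> K t v"
    and "\<forall>t\<ge>0. \<exists>V. subspace_of_dimension V K \<and> V \<subseteq> stable_cone Iminus Iplus c3 t"
    and "c4 > 3 * (1 / (c1 * c2)\<^sup>2) * (c3 + 1)"
    and "\<forall>t \<tau> v. 0 \<le> t \<and> t \<le> \<tau> \<and>
            (\<forall>t'\<in>{t..\<tau>}. blinfun_apply (S t' \<tau>) v \<in> stable_cone Iminus Iplus c4 t') \<longrightarrow>
            Iminus \<tau> v \<le> exp (lam * (\<tau> - t)) * Iminus t (blinfun_apply (S t \<tau>) v)"
    and "\<forall>t \<tau> v. 0 \<le> t \<and> t \<le> \<tau> \<and>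
            (\<forall>t'\<in>{t..\<tau>}. blinfun_apply (S t' \<tau>) v \<in> unstable_cone Iminus Iplus c3 t') \<longrightarrow>
            Iplus \<tau> v \<ge> exp (mu * (\<tau> - t)) * Iplus t (blinfun_apply (S t \<tau>) v)"
  shows "\<exists>Xs Xu. exponential_dichotomy_on S lam mu Xs Xu \<and>
           (\<forall>t\<ge>0. Xs t \<subseteq> stable_cone Iminus Iplus c3 t \<and> subspace_of_dimension (Xs t) K)"
proof -
  have Im_zero: "Iminus t v = 0" if "K = 0" "0 \<le> t" for t v
  proof -
    have "max_abs_pairing \<alpha> K t v = 0" using that(1) by (simp add: max_abs_pairing_def)
    moreover have "Iminus t v \<le> 1 / c2 * max_abs_pairing \<alpha> K t v"
      using assms(12) that(2) by blast
    ultimately have "Iminus t v \<le> 0" by simp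
    then show ?thesis using assms(2) that(2) by (meson antisym)
  qed
  \<comment> \<open>If \<open>K > 0\<close>, a nonzero vector of the stable cone forces \<open>c1 \<le> 1\<close> and \<open>c2 \<le> 1\<close>, and
    \<open>c4\<close> satisfies both gap inequalities. If \<open>K = 0\<close>, then \<open>Iminus\<close> vanishes, the growth condition
    holds for cones of every opening, and \<open>c4\<close> may be enlarged at will.\<close>
  have "\<exists>c4'. c3 < c4' \<and> c3 + 1 < (c1 * c2)\<^sup>2 * c4' \<and> (c4' = c4 \<or> K = 0)"
  proof (cases "K = 0")
    case True
    have sq: "0 < (c1 * c2)\<^sup>2" using assms(6,7) by simp
    define c4' where "c4' = max (c3 + 1) ((c3 + 2) / (c1 * c2)\<^sup>2)"
    have "c3 < c4'" "(c3 + 2) / (c1 * c2)\<^sup>2 \<le> c4'" unfolding c4'_def by auto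
    then have "c3 < c4'" "c3 + 2 \<le> (c1 * c2)\<^sup>2 * c4'"
      using sq by (simp_all add: pos_divide_le_eq mult.commute)
    then show ?thesis using True by (intro exI[of _ c4']) auto
  next
    case False
    obtain V where V: "subspace_of_dimension V K" "V \<subseteq> stable_cone Iminus Iplus c3 0"
      using assms(13) by blast
    obtain B where B: "card B = K" "independent B" "span B = V"
      using V(1) unfolding subspace_of_dimension_def by blast
    obtain b where "b \<in> B" using B(1) False by fastforce
    then have b: "b \<in> V" "b \<noteq> 0" using B span_base dependent_zero by blast+
    have "c1 * norm b \<le> 1 / c1 * norm b" using assms(11) by (meson order_refl order_trans)
    then have c1: "c1 * c1 \<le> 1" using b(2) assms(6) by (simp add: field_simps)
    have M: "c2 * max_abs_pairing \<alpha> K 0 b \<le> Iminus 0 b"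
      "Iminus 0 b \<le> 1 / c2 * max_abs_pairing \<alpha> K 0 b" using assms(12) by auto
    have "0 < c1 * norm b" using b(2) assms(6) by simp
    also have "\<dots> \<le> Iminus 0 b + Iplus 0 b" using assms(11) by auto
    also have "\<dots> \<le> (1 + c3) * Iminus 0 b"
      using V(2) b(1) unfolding stable_cone_def by (auto simp: algebra_simps)
    finally have "0 < (1 + c3) * Iminus 0 b" .
    then have "0 < Iminus 0 b" by (rule zero_less_mult_pos) (use assms(8) in simp)
    then have "0 < 1 / c2 * max_abs_pairing \<alpha> K 0 b" using M(2) by simp
    then have "0 < max_abs_pairing \<alpha> K 0 b" by (rule zero_less_mult_pos) (use assms(7) in simp)
    moreover have "c2 * max_abs_pairing \<alpha> K 0 b \<le> 1 / c2 * max_abs_pairing \<alpha> K 0 b"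
      using M by linarith
    ultimately have "c2 * c2 \<le> 1" using assms(7) by (simp add: field_simps)
    with c1 have "(c1 * c1) * (c2 * c2) \<le> 1 * 1" by (intro mult_mono) auto
    then have le: "(c1 * c2)\<^sup>2 \<le> 1" by (simp add: power2_eq_square mult_ac)
    have sq: "0 < (c1 * c2)\<^sup>2" using assms(6,7) by simp
    have "3 * (c3 + 1) < (c1 * c2)\<^sup>2 * c4" using assms(14) sq by (simp add: field_simps)
    moreover have "(c1 * c2)\<^sup>2 * c4 \<le> 1 * c4" using le assms(9) by (intro mult_right_mono) auto
    ultimately show ?thesis using assms(8) by (intro exI[of _ c4]) auto
  qed
  then obtain c4' where c4': "c3 < c4'" "c3 + 1 < (c1 * c2)\<^sup>2 * c4'" "c4' = c4 \<or> K = 0" by blast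
  interpret invariant_cones S Iminus Iplus \<alpha> c1 c2 c3 c4' lam mu K
  proof
    show "Iminus \<tau> v \<le> exp (lam * (\<tau> - t)) * Iminus t (S t \<tau> v)"
      if t: "0 \<le> t" "t \<le> \<tau>"
        and cone: "\<And>t'. t' \<in> {t..\<tau>} \<Longrightarrow> S t' \<tau> v \<in> stable_cone Iminus Iplus c4' t'" for t \<tau> v
    proof (cases "K = 0")
      case True
      then show ?thesis using Im_zero t by simp
    next
      case False
      then show ?thesis using assms(15) c4'(3) t cone by blast
    qed
  qed (use assms c4' in \<open>simp_all\<close>)
  show ?thesis using dichotomy stable_space_in_stable_cone dimension_stable_space by blast
qed

end
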